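(* Let $\mathbf{A}$ be a finite category equivalent to some category with Möbius inversion. Then $\mathbf{A}$ has both Euler characteristic and series Euler characteristic, and $\chi(\mathbf{A}) = \chi_\Sigma(\mathbf{A})$.
   Context: A finite category is a category with finitely many objects and finitely many arrows. For a finite category $\mathbf{A}$ with objects $a_1,\ldots,a_m$, let $Z_{\mathbf{A}}$ be the $m\times m$ matrix over $\mathbb{Q}$ whose $(i,j)$-entry is the number of arrows from $a_i$ to $a_j$. A finite category $\mathbf{A}$ has Möbius inversion if $Z_{\mathbf{A}}$ is invertible (over $\mathbb{Q}$). A weighting on $\mathbf{A}$ is a tuple $(w^1,\ldots,w^m)\in\mathbb{Q}^m$ such that $\sum_j (Z_{\mathbf{A}})_{ij} w^j = 1$ for all $i$. A coweighting on $\mathbf{A}$ is a tuple $(w_1,\ldots,w_m)\in\mathbb{Q}^m$ such that $\sum_i w_i (Z_{\mathbf{A}})_{ij} = 1$ for all $j$. If $(w^i)$ is a weighting and $(w_i)$ a coweighting then $\sum_i w^i = \sum_i w_i$. $\mathbf{A}$ has Euler characteristic if it admits both a weighting and a coweighting; in that case its Euler characteristic is $\chi(\mathbf{A}) = \sum_i w^i = \sum_i w_i$, for any weighting $(w^i)$ and coweighting $(w_i)$. Let $c_n$ be the number of nondegenerate $n$-simplices of the nerve of $\mathbf{A}$, i.e. the number of chains $x_0 \xrightarrow{\phi_1} x_1 \to \cdots \xrightarrow{\phi_n} x_n$ of arrows in $\mathbf{A}$ with no $\phi_i$ an identity ($c_0$ is the number of objects), and let $f_{\mathbf{A}}(t)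 = \sum_{n\ge 0} c_n t^n \in \mathbb{Q}[[t]]$. This power series is rational, that is, it equals (in the field of formal Laurent series $\mathbb{Q}((t))$) a rational expression in $\mathbb{Q}(t)$, namely $$f_{\mathbf{A}}(t) = \frac{s(\mathrm{adj}(I-(Z_{\mathbf{A}}-I)t))}{\det(I-(Z_{\mathbf{A}}-I)t)},$$ where $\mathrm{adj}$ is the adjugate and $s(M)=\sum_{i,j}M_{ij}$. Evaluating this element of $\mathbb{Q}(t)$ (written in lowest terms) at $t=-1$ gives $f_{\mathbf{A}}(-1)\in\mathbb{Q}\cup\{\infty\}$. $\mathbf{A}$ has series Euler characteristic if $f_{\mathbf{A}}(-1)\in\mathbb{Q}$ (no pole at $-1$), and then its series Euler characteristic is $\chi_\Sigma(\mathbf{A}) = f_{\mathbf{A}}(-1)$. *)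

theory Defs
  imports
    "HOL-Computational_Algebra.Computational_Algebra"
    "HOL-Computational_Algebra.Field_as_Ring"
    "Jordan_Normal_Form.Matrix"
begin

no_notation fps_nth (infixl "$" 75)

section \<open>Categories, functors, equivalence\<close>

text \<open>Composition is written in applicative order: \<open>comp C g f\<close> is ``g after f''.\<close>

record ('o, 'm) cat =
  obj :: "'o set"
  arr :: "'m set"
  src :: "'m \<Rightarrow> 'o"
  tgt :: "'m \<Rightarrow> 'o"
  ident :: "'o \<Rightarrow> 'm"
  comp :: "'m \<Rightarrow> 'm \<Rightarrow> 'm"

definition homset :: "('o, 'm) cat \<Rightarrow> 'o \<Rightarrow> 'o \<Rightarrow> 'm set" where
  "homset C x y = {f \<in> arr C. src C f = x \<and> tgt C f = y}"

locale category =
  fixes C :: "('o, 'm) cat"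
  assumes src_obj: "f \<in> arr C \<Longrightarrow> src C f \<in> obj C"
    and tgt_obj: "f \<in> arr C \<Longrightarrow> tgt C f \<in> obj C"
    and ident_hom: "x \<in> obj C \<Longrightarrow> ident C x \<in> homset C x x"
    and comp_hom: "f \<in> homset C x y \<Longrightarrow> g \<in> homset C y z \<Longrightarrow> comp C g f \<in> homset C x z"
    and comp_ident_left: "f \<in> homset C x y \<Longrightarrow> comp C (ident C y) f = f"
    and comp_ident_right: "f \<in> homset C x y \<Longrightarrow> comp C f (ident C x) = f"
    and comp_assoc: "f \<in> homset C w x \<Longrightarrow> g \<in> homset C x y \<Longrightarrow> h \<in> homset C y z
      \<Longrightarrow> comp C h (comp C g f) = comp C (comp C h g) f"

locale finite_category = category +
  assumes finite_obj: "finite (obj C)"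
    and finite_arr: "finite (arr C)"

record ('o, 'm, 'p, 'n) ftr =
  on_obj :: "'o \<Rightarrow> 'p"
  on_arr :: "'m \<Rightarrow> 'n"

definition is_functor :: "('o, 'm) cat \<Rightarrow> ('p, 'n) cat \<Rightarrow> ('o, 'm, 'p, 'n) ftr \<Rightarrow> bool" where
  "is_functor C D F \<longleftrightarrow>
     (\<forall>x\<in>obj C. on_obj F x \<in> obj D) \<and>
     (\<forall>f\<in>arr C. on_arr F f \<in> homset D (on_obj F (src C f)) (on_obj F (tgt C f))) \<and>
     (\<forall>x\<in>obj C. on_arr F (ident C x) = ident D (on_obj F x)) \<and>
     (\<forall>f\<in>arr C. \<forall>g\<in>arr C. tgt C f = src C g \<longrightarrow>
        on_arr F (comp C g f) = comp D (on_arr F g) (on_arr F f))"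

definition ftr_id :: "('o, 'm, 'o, 'm) ftr" where
  "ftr_id = \<lparr>on_obj = (\<lambda>x. x), on_arr = (\<lambda>f. f)\<rparr>"

definition ftr_comp ::
  "('p, 'n, 'q, 'l) ftr \<Rightarrow> ('o, 'm, 'p, 'n) ftr \<Rightarrow> ('o, 'm, 'q, 'l) ftr" where
  "ftr_comp G F = \<lparr>on_obj = on_obj G \<circ> on_obj F, on_arr = on_arr G \<circ> on_arr F\<rparr>"

definition is_iso :: "('o, 'm) cat \<Rightarrow> 'm \<Rightarrow> bool" where
  "is_iso C f \<longleftrightarrow> f \<in> arr C \<and>
     (\<exists>g \<in> homset C (tgt C f) (src C f).
        comp C g f = ident C (src C f) \<and> comp C f g = ident C (tgt C f))"

definition nat_iso :: "('o, 'm) cat \<Rightarrow> ('p, 'n) cat \<Rightarrow>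
    ('o, 'm, 'p, 'n) ftr \<Rightarrow> ('o, 'm, 'p, 'n) ftr \<Rightarrow> ('o \<Rightarrow> 'n) \<Rightarrow> bool" where
  "nat_iso C D F G \<tau> \<longleftrightarrow>
     (\<forall>x\<in>obj C. \<tau> x \<in> homset D (on_obj F x) (on_obj G x) \<and> is_iso D (\<tau> x)) \<and>
     (\<forall>f\<in>arr C. comp D (\<tau> (tgt C f)) (on_arr F f) = comp D (on_arr G f) (\<tau> (src C f)))"

definition equivalent_cat :: "('o, 'm) cat \<Rightarrow> ('p, 'n) cat \<Rightarrow> bool" where
  "equivalent_cat C D \<longleftrightarrow>
     (\<exists>F G \<eta> \<epsilon>. is_functor C D F \<and> is_functor D C G \<and>
        nat_iso C C ftr_id (ftr_comp G F) \<eta> \<and> nat_iso D D (ftr_comp F G) ftr_id \<epsilon>)"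

section \<open>The matrix of a finite category, weightings, Euler characteristic\<close>

text \<open>
  The enumeration of the objects is an arbitrary fixed one; different choices
  conjugate the matrix by a permutation matrix and permute the weightings accordingly.
  Indices run from 0. The category without objects is allowed, with a 0-by-0 matrix.
\<close>

definition obj_list :: "('o, 'm) cat \<Rightarrow> 'o list" where
  "obj_list C = (SOME xs. distinct xs \<and> set xs = obj C)"

definition zeta_mat :: "('o, 'm) cat \<Rightarrow> rat mat" where
  "zeta_mat C = mat (card (obj C)) (card (obj C))
     (\<lambda>(i, j). of_nat (card (homset C (obj_list C ! i) (obj_list C ! j))))"

definition has_moebius_inversion :: "('o, 'm) cat \<Rightarrow> bool" where
  "has_moebius_inversion C \<longleftrightarrow> invertible_mat (zeta_mat C)"

definition weighting :: "('o, 'm) cat \<Rightarrow> rat vec \<Rightarrow> bool" where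
  "weighting C w \<longleftrightarrow> w \<in> carrier_vec (card (obj C)) \<and>
     (\<forall>i < card (obj C). (\<Sum>j < card (obj C). zeta_mat C $$ (i, j) * w $ j) = 1)"

definition coweighting :: "('o, 'm) cat \<Rightarrow> rat vec \<Rightarrow> bool" where
  "coweighting C w \<longleftrightarrow> w \<in> carrier_vec (card (obj C)) \<and>
     (\<forall>j < card (obj C). (\<Sum>i < card (obj C). w $ i * zeta_mat C $$ (i, j)) = 1)"

definition has_euler_char :: "('o, 'm) cat \<Rightarrow> bool" where
  "has_euler_char C \<longleftrightarrow> (\<exists>w. weighting C w) \<and> (\<exists>v. coweighting C v)"

definition euler_char :: "('o, 'm) cat \<Rightarrow> rat" where
  "euler_char C = (THE x. \<exists>w v. weighting C w \<and> coweighting C v \<and>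
     x = (\<Sum>i < card (obj C). w $ i) \<and> x = (\<Sum>i < card (obj C). v $ i))"

lemma sum_weighting_eq_sum_coweighting:
  assumes "weighting C w" "coweighting C v"
  shows "(\<Sum>i < card (obj C). w $ i) = (\<Sum>i < card (obj C). v $ i)"
proof -
  let ?m = "card (obj C)" and ?Z = "zeta_mat C"
  have "(\<Sum>j<?m. w $ j) = (\<Sum>j<?m. (\<Sum>i<?m. v $ i * ?Z $$ (i, j)) * w $ j)"
    using assms(2) by (intro sum.cong) (auto simp: coweighting_def)
  also have "\<dots> = (\<Sum>i<?m. v $ i * (\<Sum>j<?m. ?Z $$ (i, j) * w $ j))"
    unfolding sum_distrib_left sum_distrib_right
    by (subst sum.swap) (simp add: mult.assoc)
  also have "\<dots> = (\<Sum>i<?m. v $ i)"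
    using assms(1) by (intro sum.cong) (auto simp: weighting_def)
  finally show ?thesis .
qed

lemma euler_char_eq:
  assumes "weighting C w" "coweighting C v"
  shows "euler_char C = (\<Sum>i < card (obj C). w $ i)"
    and "euler_char C = (\<Sum>i < card (obj C). v $ i)"
proof -
  show "euler_char C = (\<Sum>i < card (obj C). w $ i)"
    unfolding euler_char_def
  proof (rule the_equality)
    show "\<exists>w' v'. weighting C w' \<and> coweighting C v' \<and>
        (\<Sum>i < card (obj C). w $ i) = (\<Sum>i < card (obj C). w' $ i) \<and>
        (\<Sum>i < card (obj C). w $ i) = (\<Sum>i < card (obj C). v' $ i)"
      using assms sum_weighting_eq_sum_coweighting[OF assms] by blast
    show "x = (\<Sum>i < card (obj C). w $ i)"
      if "\<exists>w' v'. weighting C w' \<and> coweighting C v' \<and>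
        x = (\<Sum>i < card (obj C). w' $ i) \<and> x = (\<Sum>i < card (obj C). v' $ i)" for x
      using that sum_weighting_eq_sum_coweighting[OF assms(1)] by auto
  qed
  then show "euler_char C = (\<Sum>i < card (obj C). v $ i)"
    using sum_weighting_eq_sum_coweighting[OF assms] by simp
qed

section \<open>Rational functions over the rationals\<close>

text \<open>
  The library function \<open>quot_of_fract\<close> yields numerator and denominator in lowest terms.
\<close>

definition fls_of_ratfun :: "rat poly fract \<Rightarrow> rat fls" where
  "fls_of_ratfun r = fps_to_fls (fps_of_poly (fst (quot_of_fract r)))
                   / fps_to_fls (fps_of_poly (snd (quot_of_fract r)))"

lemma inj_fls_of_ratfun: "inj fls_of_ratfun"
proof (rule injI)
  fix r s :: "rat poly fract"
  assume eq: "fls_of_ratfun r = fls_of_ratfun s"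
  define a b c d where "a = fst (quot_of_fract r)" and "b = snd (quot_of_fract r)"
    and "c = fst (quot_of_fract s)" and "d = snd (quot_of_fract s)"
  have nz: "b \<noteq> 0" "d \<noteq> 0" by (simp_all add: b_def d_def)
  have "fps_to_fls (fps_of_poly (a * d)) = fps_to_fls (fps_of_poly (c * b))"
    using eq nz unfolding fls_of_ratfun_def a_def[symmetric] b_def[symmetric]
      c_def[symmetric] d_def[symmetric]
    by (simp add: fps_of_poly_mult fls_times_fps_to_fls frac_eq_eq)
  then have "a * d = c * b" by (simp add: fps_of_poly_eq_iff)
  then have "Fract a b = Fract c d" using nz by (simp add: eq_fract)
  then show "r = s" by (simp add: a_def b_def c_def d_def)
qed

text \<open>The result \<open>None\<close> stands for the value \<open>\<infinity>\<close>, i.e. for a pole.\<close>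

definition eval_ratfun :: "rat poly fract \<Rightarrow> rat \<Rightarrow> rat option" where
  "eval_ratfun r x =
     (if poly (snd (quot_of_fract r)) x = 0 then None
      else Some (poly (fst (quot_of_fract r)) x / poly (snd (quot_of_fract r)) x))"

section \<open>Nondegenerate simplices of the nerve and series Euler characteristic\<close>

text \<open>
  A chain of arrows is given by its initial object together with the list of its arrows,
  so that the chains of length 0 are exactly the objects.
\<close>

fun path_from :: "('o, 'm) cat \<Rightarrow> 'o \<Rightarrow> 'm list \<Rightarrow> bool" where
  "path_from C x [] \<longleftrightarrow> x \<in> obj C"
| "path_from C x (f # fs) \<longleftrightarrow> f \<in> arr C \<and> src C f = x \<and> path_from C (tgt C f) fs"

definition nondegenerate_simplices :: "('o, 'm) cat \<Rightarrow> nat \<Rightarrow> ('o \<times> 'm list) set" where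
  "nondegenerate_simplices C n =
     {(x, fs). path_from C x fs \<and> length fs = n \<and> (\<forall>f\<in>set fs. f \<notin> ident C ` obj C)}"

definition nerve_series :: "('o, 'm) cat \<Rightarrow> rat fps" where
  "nerve_series C = Abs_fps (\<lambda>n. of_nat (card (nondegenerate_simplices C n)))"

definition represents_nerve_series :: "('o, 'm) cat \<Rightarrow> rat poly fract \<Rightarrow> bool" where
  "represents_nerve_series C r \<longleftrightarrow> fls_of_ratfun r = fps_to_fls (nerve_series C)"

text \<open>
  There is at most one representing rational function, by \<open>inj_fls_of_ratfun\<close>.
\<close>

definition has_series_euler_char :: "('o, 'm) cat \<Rightarrow> bool" where
  "has_series_euler_char C \<longleftrightarrow>
     (\<exists>r. represents_nerve_series C r \<and> eval_ratfun r (-1) \<noteq> None)"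

definition series_euler_char :: "('o, 'm) cat \<Rightarrow> rat" where
  "series_euler_char C = the (eval_ratfun (THE r. represents_nerve_series C r) (-1))"

end

theory Submission
  imports Defs "Jordan_Normal_Form.Determinant"
begin

text \<open>
  Objects of \<open>B\<close> isomorphic to one another give equal rows of \<open>Z\<^sub>B\<close>, so \<open>B\<close> is skeletal and the
  equivalence is surjective on objects; hence \<open>Z\<^sub>A = P Z\<^sub>B P\<^sup>T\<close> with \<open>P\<close> the incidence matrix of
  the object map, and \<open>N = P\<^sup>T P\<close> is the invertible diagonal matrix of fibre sizes. Dividing
  the (co)weights of \<open>B\<close> by the fibre sizes gives (co)weights of \<open>A\<close> with the same sum. The
  number of nondegenerate chains starting at \<open>a\<close> depends only on the image of \<open>a\<close>, and the counts
  are the iterates of \<open>Z\<^sub>B N - I\<close> applied to \<open>1\<close>. So the nerve series is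
  \<open>1\<^sup>T N ((1 + t)I - t Z\<^sub>B N)\<^sup>-\<^sup>1 1\<close>, which has no pole at \<open>t = -1\<close> and takes there the value
  \<open>1\<^sup>T Z\<^sub>B\<^sup>-\<^sup>1 1\<close>, the sum of the weights of \<open>B\<close>.
\<close>

section \<open>Hom-sets of equivalent categories\<close>

definition isomorphic :: "('o, 'm) cat \<Rightarrow> 'o \<Rightarrow> 'o \<Rightarrow> bool" where
  "isomorphic C x y \<longleftrightarrow> (\<exists>e \<in> homset C x y. is_iso C e)"

context category
begin

lemma iso_cancel_left:
  assumes "is_iso C e" "e \<in> homset C y z" "f \<in> homset C x y" "g \<in> homset C x y"
    and "comp C e f = comp C e g"
  shows "f = g"
proof -
  obtain e' where e': "e' \<in> homset C z y" "comp C e' e = ident C y"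
    using assms(1,2) by (auto simp: is_iso_def homset_def)
  have "comp C e' (comp C e h) = h" if "h \<in> homset C x y" for h
    using comp_assoc[OF that assms(2) e'(1)] comp_ident_left[OF that] e'(2) by simp
  then show ?thesis using assms(3-5) by metis
qed

lemma iso_cancel_right:
  assumes "is_iso C e" "e \<in> homset C x y" "f \<in> homset C y z" "g \<in> homset C y z"
    and "comp C f e = comp C g e"
  shows "f = g"
proof -
  obtain e' where e': "e' \<in> homset C y x" "comp C e e' = ident C y"
    using assms(1,2) by (auto simp: is_iso_def homset_def)
  have "comp C (comp C h e) e' = h" if "h \<in> homset C y z" for h
    using comp_assoc[OF e'(1) assms(2) that] comp_ident_right[OF that] e'(2) by simp
  then show ?thesis using assms(3-5) by metis
qed

lemma isomorphic_refl: "x \<in> obj C \<Longrightarrow> isomorphic C x x"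
  using ident_hom[of x] comp_ident_left[OF ident_hom[of x]]
  by (auto simp: isomorphic_def is_iso_def homset_def intro!: bexI[of _ "ident C x"])

lemma isomorphic_sym:
  assumes "isomorphic C x y"
  shows "isomorphic C y x"
proof -
  obtain e e' where "e \<in> homset C x y" "e' \<in> homset C y x"
    "comp C e' e = ident C x" "comp C e e' = ident C y"
    using assms by (auto simp: isomorphic_def is_iso_def homset_def)
  then have "e' \<in> homset C y x \<and> is_iso C e'"
    unfolding is_iso_def homset_def by auto
  then show ?thesis by (auto simp: isomorphic_def)
qed

end

context finite_category
begin

lemma finite_homset: "finite (homset C x y)"
  by (rule finite_subset[OF _ finite_arr]) (auto simp: homset_def)

text \<open>The map \<open>f \<mapsto> d f e\<close>, with isomorphisms \<open>e\<close> from
  \<open>x'\<close> to \<open>x\<close> and \<open>d\<close> from \<open>y\<close> to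
  \<open>y'\<close>, is injective by cancellation on both sides. Symmetry of
  \<open>isomorphic\<close> then turns the inequality into an equality.\<close>

lemma card_homset_mono:
  assumes "isomorphic C x x'" "isomorphic C y y'"
  shows "card (homset C x y) \<le> card (homset C x' y')"
proof -
  obtain e where e: "e \<in> homset C x' x" "is_iso C e"
    using isomorphic_sym[OF assms(1)] by (auto simp: isomorphic_def)
  obtain d where d: "d \<in> homset C y y'" "is_iso C d"
    using assms(2) by (auto simp: isomorphic_def)
  have "inj_on (\<lambda>f. comp C d (comp C f e)) (homset C x y)"
  proof (rule inj_onI)
    fix f g assume fg: "f \<in> homset C x y" "g \<in> homset C x y"
      and eq: "comp C d (comp C f e) = comp C d (comp C g e)"
    have "comp C f e = comp C g e"
      using iso_cancel_left[OF d(2,1) comp_hom[OF e(1) fg(1)] comp_hom[OF e(1) fg(2)] eq] .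
    then show "f = g" by (rule iso_cancel_right[OF e(2,1) fg])
  qed
  moreover have "(\<lambda>f. comp C d (comp C f e)) ` homset C x y \<subseteq> homset C x' y'"
    using comp_hom d(1) e(1) by blast
  ultimately show ?thesis by (rule card_inj_on_le[OF _ _ finite_homset])
qed

lemma card_homset_cong:
  assumes "isomorphic C x x'" "isomorphic C y y'"
  shows "card (homset C x y) = card (homset C x' y')"
  using card_homset_mono assms isomorphic_sym by (meson le_antisym)

end

section \<open>Equivalences preserve the sizes of hom-sets\<close>

lemma functor_homset:
  "is_functor C D F \<Longrightarrow> f \<in> homset C x y \<Longrightarrow> on_arr F f \<in> homset D (on_obj F x) (on_obj F y)"
  unfolding is_functor_def homset_def[of C] by auto

text \<open>Naturality of the unit gives \<open>\<eta> y f = G(F f) \<eta> x\<close>, so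
  \<open>F f\<close> determines \<open>\<eta> y f\<close>, and the isomorphism
  \<open>\<eta> y\<close> cancels.\<close>

lemma faithful_of_unit:
  assumes "category C" "is_functor C D F" "is_functor D C G"
    and nat: "nat_iso C C ftr_id (ftr_comp G F) \<eta>"
    and "x \<in> obj C" "y \<in> obj C"
  shows "inj_on (on_arr F) (homset C x y)"
proof (rule inj_onI)
  interpret category C by fact
  fix f g assume fg: "f \<in> homset C x y" "g \<in> homset C x y" "on_arr F f = on_arr F g"
  have "\<eta> y \<in> homset C y (on_obj G (on_obj F y))" "is_iso C (\<eta> y)"
    using nat \<open>y \<in> obj C\<close> by (auto simp: nat_iso_def ftr_id_def ftr_comp_def)
  moreover have "comp C (\<eta> y) h = comp C (on_arr G (on_arr F h)) (\<eta> x)"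
    if "h \<in> homset C x y" for h
    using nat that by (auto simp: nat_iso_def ftr_id_def ftr_comp_def homset_def)
  then have "comp C (\<eta> y) f = comp C (\<eta> y) g" using fg by simp
  ultimately show "f = g" using iso_cancel_left fg(1,2) by blast
qed

text \<open>Dual to \<open>faithful_of_unit\<close>: here the counit component
  \<open>\<epsilon> x\<close> is cancelled on the right.\<close>

lemma faithful_of_counit:
  assumes "category D" "is_functor C D F" "is_functor D C G"
    and nat: "nat_iso D D (ftr_comp F G) ftr_id \<epsilon>"
    and "x \<in> obj D" "y \<in> obj D"
  shows "inj_on (on_arr G) (homset D x y)"
proof (rule inj_onI)
  interpret category D by fact
  fix f g assume fg: "f \<in> homset D x y" "g \<in> homset D x y" "on_arr G f = on_arr G g"
  have "\<epsilon> x \<in> homset D (on_obj F (on_obj G x)) x" "is_iso D (\<epsilon> x)"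
    using nat \<open>x \<in> obj D\<close> by (auto simp: nat_iso_def ftr_id_def ftr_comp_def)
  moreover have "comp D h (\<epsilon> x) = comp D (\<epsilon> y) (on_arr F (on_arr G h))"
    if "h \<in> homset D x y" for h
    using nat that by (auto simp: nat_iso_def ftr_id_def ftr_comp_def homset_def)
  then have "comp D f (\<epsilon> x) = comp D g (\<epsilon> x)" using fg by simp
  ultimately show "f = g" using iso_cancel_right fg(1,2) by blast
qed

text \<open>Reduces the equivalence to counting data. Hom-sets are finite, so two injections give
  equal sizes: \<open>F\<close> maps \<open>A(x, y)\<close> into \<open>B(F x, F y)\<close>, and
  \<open>G\<close> maps the latter into \<open>A(G F x, G F y)\<close>, which is as large as
  \<open>A(x, y)\<close> because the unit is an isomorphism. The counit makes \<open>G b\<close> a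
  preimage of \<open>b\<close> up to isomorphism.\<close>

lemma equivalence_object_map:
  assumes "finite_category A" "finite_category B" "equivalent_cat A B"
  obtains \<phi> where "\<And>x. x \<in> obj A \<Longrightarrow> \<phi> x \<in> obj B"
    and "\<And>x y. x \<in> obj A \<Longrightarrow> y \<in> obj A \<Longrightarrow>
      card (homset A x y) = card (homset B (\<phi> x) (\<phi> y))"
    and "\<And>b. b \<in> obj B \<Longrightarrow> \<exists>x\<in>obj A. isomorphic B (\<phi> x) b"
proof -
  interpret A: finite_category A by fact
  interpret B: finite_category B by fact
  obtain F G \<eta> \<epsilon> where F: "is_functor A B F" and G: "is_functor B A G"
    and \<eta>: "nat_iso A A ftr_id (ftr_comp G F) \<eta>" and \<epsilon>: "nat_iso B B (ftr_comp F G) ftr_id \<epsilon>"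
    using assms(3) by (auto simp: equivalent_cat_def)
  have F_obj: "on_obj F x \<in> obj B" if "x \<in> obj A" for x
    using F that by (auto simp: is_functor_def)
  have G_obj: "on_obj G x \<in> obj A" if "x \<in> obj B" for x
    using G that by (auto simp: is_functor_def)
  have iso: "isomorphic A (on_obj G (on_obj F x)) x" if "x \<in> obj A" for x
    by (rule A.isomorphic_sym)
      (use \<eta> that in \<open>auto simp: nat_iso_def isomorphic_def ftr_id_def ftr_comp_def\<close>)
  show ?thesis
  proof
    show "on_obj F x \<in> obj B" if "x \<in> obj A" for x using F_obj[OF that] .
    show "\<exists>x\<in>obj A. isomorphic B (on_obj F x) b" if "b \<in> obj B" for b
      using \<epsilon> that G_obj
      by (auto simp: nat_iso_def isomorphic_def ftr_id_def ftr_comp_def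
          intro!: bexI[of _ "on_obj G b"])
    show "card (homset A x y) = card (homset B (on_obj F x) (on_obj F y))"
      if xy: "x \<in> obj A" "y \<in> obj A" for x y
    proof (rule antisym)
      show "card (homset A x y) \<le> card (homset B (on_obj F x) (on_obj F y))"
        using faithful_of_unit[OF A.category_axioms F G \<eta> xy] functor_homset[OF F]
        by (intro card_inj_on_le[OF _ _ B.finite_homset]) auto
      have "card (homset B (on_obj F x) (on_obj F y))
          \<le> card (homset A (on_obj G (on_obj F x)) (on_obj G (on_obj F y)))"
        using faithful_of_counit[OF B.category_axioms F G \<epsilon> F_obj[OF xy(1)] F_obj[OF xy(2)]]
          functor_homset[OF G]
        by (intro card_inj_on_le[OF _ _ A.finite_homset]) auto
      also have "\<dots> = card (homset A x y)"
        using A.card_homset_cong iso xy by blast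
      finally show "card (homset B (on_obj F x) (on_obj F y)) \<le> card (homset A x y)" .
    qed
  qed
qed

section \<open>Nondegenerate simplices\<close>

context finite_category
begin

text \<open>Slicing by the initial object turns the simplex counts into vectors indexed by objects,
  which obey a linear recursion.\<close>

definition chains_from :: "nat \<Rightarrow> 'a \<Rightarrow> 'b list set" where
  "chains_from n x = {fs. (x, fs) \<in> nondegenerate_simplices C n}"

lemma chains_from_0: "x \<in> obj C \<Longrightarrow> chains_from 0 x = {[]}"
  by (auto simp: chains_from_def nondegenerate_simplices_def)

lemma chains_from_Suc:
  "chains_from (Suc n) x =
    (\<Union>y\<in>obj C. (\<lambda>(f, fs). f # fs) `
      ((homset C x y - ident C ` obj C) \<times> chains_from n y))"
  (is "?L = ?R")
proof
  show "?R \<subseteq> ?L"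
    by (auto simp: chains_from_def nondegenerate_simplices_def homset_def) blast
  show "?L \<subseteq> ?R"
  proof
    fix gs assume gs: "gs \<in> ?L"
    then obtain f fs where "gs = f # fs"
      by (auto simp: chains_from_def nondegenerate_simplices_def length_Suc_conv)
    then show "gs \<in> ?R"
      using gs tgt_obj[of f]
      by (auto simp: chains_from_def nondegenerate_simplices_def homset_def
          intro!: bexI[of _ "tgt C f"])
  qed
qed

lemma finite_chains_from: "x \<in> obj C \<Longrightarrow> finite (chains_from n x)"
proof (induction n arbitrary: x)
  case 0
  then show ?case by (simp add: chains_from_0)
next
  case (Suc n)
  then show ?case
    unfolding chains_from_Suc
    by (intro finite_UN_I finite_imageI finite_cartesian_product finite_Diff finite_obj finite_homset)
      auto
qed

text \<open>These are the entries of \<open>Z - I\<close>: an identity has equal ends, so only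
  \<open>ident C x\<close> is removed from the endomorphisms of \<open>x\<close>, and nothing is
  removed between distinct objects.\<close>

lemma card_nonidentities:
  assumes "x \<in> obj C" "y \<in> obj C"
  shows "rat_of_nat (card (homset C x y - ident C ` obj C))
    = of_nat (card (homset C x y)) - (if x = y then 1 else 0)"
proof (cases "x = y")
  case True
  have "homset C x y - ident C ` obj C = homset C x y - {ident C x}"
    using True assms ident_hom by (auto simp: homset_def)
  moreover have "card (homset C x y) \<noteq> 0" "ident C x \<in> homset C x y"
    using ident_hom[OF assms(1)] True finite_homset by auto
  ultimately show ?thesis using True by (simp add: of_nat_diff)
next
  case False
  have "homset C x y - ident C ` obj C = homset C x y"
    using False ident_hom by (auto simp: homset_def)
  then show ?thesis using False by simp
qed

text \<open>Splitting off the first arrow applies \<open>Z - I\<close> to the vector of counts. The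
  union over \<open>y\<close> is disjoint since \<open>y\<close> is the target of that
  arrow.\<close>

lemma card_chains_from_Suc:
  assumes "x \<in> obj C"
  shows "rat_of_nat (card (chains_from (Suc n) x)) =
    (\<Sum>y\<in>obj C. of_nat (card (homset C x y)) * of_nat (card (chains_from n y)))
      - of_nat (card (chains_from n x))"
proof -
  let ?E = "\<lambda>y. homset C x y - ident C ` obj C"
  have "card (chains_from (Suc n) x)
      = (\<Sum>y\<in>obj C. card ((\<lambda>(f, fs). f # fs) ` (?E y \<times> chains_from n y)))"
    unfolding chains_from_Suc
    by (rule card_UN_disjoint)
      (simp_all add: finite_obj finite_homset finite_chains_from, auto simp: homset_def)
  also have "\<dots> = (\<Sum>y\<in>obj C. card (?E y) * card (chains_from n y))"
    by (intro sum.cong refl) (subst card_image, auto simp: inj_on_def card_cartesian_product)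
  finally have "rat_of_nat (card (chains_from (Suc n) x))
      = (\<Sum>y\<in>obj C. of_nat (card (?E y)) * of_nat (card (chains_from n y)))"
    by simp
  also have "\<dots> = (\<Sum>y\<in>obj C. of_nat (card (homset C x y)) * of_nat (card (chains_from n y))
      - (if x = y then of_nat (card (chains_from n y)) else 0))"
    using assms by (intro sum.cong refl) (simp add: card_nonidentities left_diff_distrib)
  finally show ?thesis using assms finite_obj by (simp add: sum_subtractf)
qed

lemma card_nondegenerate_simplices:
  "card (nondegenerate_simplices C n) = (\<Sum>x\<in>obj C. card (chains_from n x))"
proof -
  have "x \<in> obj C" if "path_from C x fs" for x fs
    using that src_obj by (cases fs) auto
  then have "nondegenerate_simplices C n = (SIGMA x:obj C. chains_from n x)"
    by (auto simp: chains_from_def nondegenerate_simplices_def)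
  then show ?thesis using finite_obj finite_chains_from by simp
qed

end

section \<open>Evaluating a resolvent at minus one\<close>

text \<open>
  With \<open>K = (1 + t)I - tM\<close> the generating series of the iterates of \<open>M - I\<close> solves \<open>K Y = 1\<close>.
  Cramer's rule makes \<open>det K\<close> a denominator, and \<open>K\<close> specialises to \<open>M\<close> at \<open>t = -1\<close>.
\<close>

lemma iterates_generating_function:
  fixes M :: "'a::field mat" and y :: "nat \<Rightarrow> nat \<Rightarrow> 'a" and c x :: "nat \<Rightarrow> 'a"
  assumes M: "M \<in> carrier_mat k k" and det: "det M \<noteq> 0"
    and y0: "\<And>i. i < k \<Longrightarrow> y 0 i = 1"
    and yS: "\<And>n i. i < k \<Longrightarrow> y (Suc n) i = (\<Sum>j<k. M $$ (i, j) * y n j) - y n i"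
    and x: "\<And>i. i < k \<Longrightarrow> (\<Sum>j<k. M $$ (i, j) * x j) = 1"
  obtains P Q where "poly Q (-1) \<noteq> 0"
    and "fps_of_poly Q * Abs_fps (\<lambda>n. \<Sum>i<k. c i * y n i) = fps_of_poly P"
    and "poly P (-1) = poly Q (-1) * (\<Sum>i<k. c i * x i)"
proof -
  define K :: "'a poly mat" where
    "K = mat k k (\<lambda>(i, j). (if i = j then [:1, 1:] else 0) - [:0, M $$ (i, j):])"
  have K: "K \<in> carrier_mat k k" by (simp add: K_def)
  define Q where "Q = det K"
  \<comment> \<open>\<open>R\<close> is \<open>adj K\<close> applied to the all-ones vector, so
    \<open>R i / Q\<close> is the Cramer solution of \<open>K Y = 1\<close>.\<close>
  define R where "R i = (\<Sum>j<k. adj_mat K $$ (i, j))" for i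
  define Y where "Y i = Abs_fps (\<lambda>n. y n i)" for i
  note adj = adj_mat[OF K]
  interpret ev: comm_ring_hom "\<lambda>p::'a poly. poly p (-1)" by unfold_locales auto
  \<comment> \<open>At \<open>t = -1\<close> the diagonal term \<open>1 + t\<close> vanishes and
    \<open>-t\<close> becomes 1.\<close>
  have "map_mat (\<lambda>p. poly p (-1)) K = M"
    using M by (intro eq_matI) (auto simp: K_def)
  then have Q: "poly Q (-1) \<noteq> 0"
    using det ev.hom_det[of K] by (simp add: Q_def)
  have left: "(\<Sum>j<k. adj_mat K $$ (i, j) * K $$ (j, l)) = (if i = l then Q else 0)"
    if "i < k" "l < k" for i l
  proof -
    have "(adj_mat K * K) $$ (i, l) = (\<Sum>j<k. adj_mat K $$ (i, j) * K $$ (j, l))"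
      using that K adj(1) by (auto simp: scalar_prod_def atLeast0LessThan intro!: sum.cong)
    also have "(adj_mat K * K) $$ (i, l) = (if i = l then Q else 0)"
      using that unfolding adj(3) Q_def by simp
    finally show ?thesis by simp
  qed
  have right: "(\<Sum>j<k. K $$ (i, j) * adj_mat K $$ (j, l)) = (if i = l then Q else 0)"
    if "i < k" "l < k" for i l
  proof -
    have "(K * adj_mat K) $$ (i, l) = (\<Sum>j<k. K $$ (i, j) * adj_mat K $$ (j, l))"
      using that K adj(1) by (auto simp: scalar_prod_def atLeast0LessThan intro!: sum.cong)
    also have "(K * adj_mat K) $$ (i, l) = (if i = l then Q else 0)"
      using that unfolding adj(2) Q_def by simp
    finally show ?thesis by simp
  qed
  \<comment> \<open>Compare coefficients: the constant one is \<open>y 0 i = 1\<close>, and the one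
    at \<open>n + 1\<close> vanishes by the recursion \<open>yS\<close>.\<close>
  have KY: "(\<Sum>j<k. fps_of_poly (K $$ (i, j)) * Y j) = 1" if i: "i < k" for i
  proof (rule fps_ext)
    fix n
    have lin: "fps_of_poly [:0, a:] = fps_const a * fps_X" "fps_of_poly [:1, 1 :: 'a:] = 1 + fps_X"
      for a :: 'a by (simp_all add: fps_of_poly_pCons fps_of_poly_const)
    have "(\<Sum>j<k. fps_of_poly (K $$ (i, j)) * Y j)
        = (\<Sum>j<k. (if i = j then (1 + fps_X) * Y j else 0) - fps_X * (fps_const (M $$ (i, j)) * Y j))"
      using i by (intro sum.cong refl)
        (auto simp: K_def fps_of_poly_diff lin algebra_simps)
    also have "\<dots> = (1 + fps_X) * Y i - fps_X * (\<Sum>j<k. fps_const (M $$ (i, j)) * Y j)"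
      using i by (simp add: sum_subtractf sum_distrib_left)
    finally have eq: "(\<Sum>j<k. fps_of_poly (K $$ (i, j)) * Y j)
        = (1 + fps_X) * Y i - fps_X * (\<Sum>j<k. fps_const (M $$ (i, j)) * Y j)" .
    show "fps_nth (\<Sum>j<k. fps_of_poly (K $$ (i, j)) * Y j) n = fps_nth 1 n"
      unfolding eq using y0[OF i] yS[OF i]
      by (cases n) (simp_all add: Y_def fps_sum_nth distrib_right)
  qed
  \<comment> \<open>Apply \<open>adj K\<close> to \<open>K Y = 1\<close> and use
    \<open>adj K * K = Q I\<close>.\<close>
  have QY: "fps_of_poly Q * Y i = fps_of_poly (R i)" if i: "i < k" for i
  proof -
    have "fps_of_poly (R i) = (\<Sum>j<k. fps_of_poly (adj_mat K $$ (i, j)) *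
        (\<Sum>l<k. fps_of_poly (K $$ (j, l)) * Y l))"
      by (simp add: R_def fps_of_poly_sum KY)
    also have "\<dots> = (\<Sum>l<k. fps_of_poly (\<Sum>j<k. adj_mat K $$ (i, j) * K $$ (j, l)) * Y l)"
      unfolding sum_distrib_left fps_of_poly_sum sum_distrib_right
      by (subst sum.swap) (simp add: fps_of_poly_mult mult.assoc)
    also have "\<dots> = (\<Sum>l<k. if i = l then fps_of_poly Q * Y l else 0)"
      using i by (intro sum.cong refl) (simp add: left)
    finally show ?thesis using i by simp
  qed
  \<comment> \<open>The other product, \<open>K * adj K = Q I\<close>, applied to the all-ones
    vector and evaluated at -1.\<close>
  have MR: "(\<Sum>j<k. M $$ (i, j) * poly (R j) (-1)) = poly Q (-1)" if i: "i < k" for i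
  proof -
    have "(\<Sum>j<k. M $$ (i, j) * poly (R j) (-1)) = poly (\<Sum>j<k. K $$ (i, j) * R j) (-1)"
      using i by (auto simp: poly_sum K_def intro!: sum.cong)
    also have "(\<Sum>j<k. K $$ (i, j) * R j) = (\<Sum>l<k. \<Sum>j<k. K $$ (i, j) * adj_mat K $$ (j, l))"
      unfolding R_def sum_distrib_left by (rule sum.swap)
    also have "\<dots> = (\<Sum>l<k. if i = l then Q else 0)"
      using i by (intro sum.cong refl) (simp add: right)
    finally show ?thesis using i by simp
  qed
  \<comment> \<open>Both sides solve the same system, with matrix \<open>M\<close> and constant
    right-hand side \<open>Q(-1)\<close>. As \<open>M\<close> is nonsingular, their difference
    \<open>?d\<close> is zero.\<close>
  have R: "poly (R i) (-1) = poly Q (-1) * x i" if i: "i < k" for i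
  proof -
    let ?d = "vec k (\<lambda>j. poly (R j) (-1) - poly Q (-1) * x j)"
    have "M *\<^sub>v ?d = 0\<^sub>v k"
    proof (intro eq_vecI)
      fix l assume "l < dim_vec (0\<^sub>v k :: 'a vec)"
      then have l: "l < k" by simp
      have "(M *\<^sub>v ?d) $ l = (\<Sum>j<k. M $$ (l, j) * (poly (R j) (-1) - poly Q (-1) * x j))"
        using l M by (auto simp: scalar_prod_def atLeast0LessThan intro!: sum.cong)
      also have "\<dots> = (\<Sum>j<k. M $$ (l, j) * poly (R j) (-1))
          - poly Q (-1) * (\<Sum>j<k. M $$ (l, j) * x j)"
        unfolding sum_distrib_left sum_subtractf[symmetric]
        by (intro sum.cong) (simp_all add: algebra_simps)
      finally show "(M *\<^sub>v ?d) $ l = 0\<^sub>v k $ l" using MR[OF l] x[OF l] l by simp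
    qed (use M in auto)
    then have "?d = 0\<^sub>v k"
      using det_0_iff_vec_prod_zero_field[OF M] det by (metis vec_carrier)
    then have "?d $ i = 0\<^sub>v k $ i" by simp
    then show ?thesis using i by simp
  qed
  show ?thesis
  proof
    show "poly Q (-1) \<noteq> 0" by (fact Q)
    have "Abs_fps (\<lambda>n. \<Sum>i<k. c i * y n i) = (\<Sum>i<k. fps_const (c i) * Y i)"
      by (rule fps_ext) (simp add: fps_sum_nth Y_def)
    then have "fps_of_poly Q * Abs_fps (\<lambda>n. \<Sum>i<k. c i * y n i)
        = (\<Sum>i<k. fps_const (c i) * (fps_of_poly Q * Y i))"
      by (simp add: sum_distrib_left algebra_simps)
    also have "\<dots> = fps_of_poly (\<Sum>i<k. Polynomial.smult (c i) (R i))"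
      by (simp add: QY fps_of_poly_sum fps_of_poly_smult)
    finally show "fps_of_poly Q * Abs_fps (\<lambda>n. \<Sum>i<k. c i * y n i)
        = fps_of_poly (\<Sum>i<k. Polynomial.smult (c i) (R i))" .
    show "poly (\<Sum>i<k. Polynomial.smult (c i) (R i)) (-1) = poly Q (-1) * (\<Sum>i<k. c i * x i)"
      by (simp add: poly_sum R sum_distrib_left algebra_simps)
  qed
qed

section \<open>Unreduced fractions representing the nerve series\<close>

lemma quot_of_fract_cross:
  assumes "Q \<noteq> 0"
  shows "fst (quot_of_fract (Fract P Q)) * Q = P * snd (quot_of_fract (Fract P Q))"
proof -
  have "Fract (fst (quot_of_fract (Fract P Q))) (snd (quot_of_fract (Fract P Q))) = Fract P Q"
    by simp
  then show ?thesis using assms by (subst (asm) eq_fract) auto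
qed

text \<open>The embedding is defined through the reduced fraction \<open>p / q\<close>.
  Cross-multiplying with \<open>P / Q\<close> and cancelling \<open>Q\<close> among power series
  gives \<open>p = f q\<close>.\<close>

lemma fls_of_ratfun_Fract:
  assumes "Q \<noteq> 0" "fps_of_poly Q * f = fps_of_poly P"
  shows "fls_of_ratfun (Fract P Q) = fps_to_fls f"
proof -
  define p q where pq: "p = fst (quot_of_fract (Fract P Q))" "q = snd (quot_of_fract (Fract P Q))"
  have "q \<noteq> 0" by (simp add: pq)
  have "fps_of_poly Q * fps_of_poly p = fps_of_poly (p * Q)"
    by (simp add: fps_of_poly_mult)
  also have "p * Q = P * q"
    using quot_of_fract_cross[OF assms(1)] by (simp add: pq)
  also have "fps_of_poly (P * q) = fps_of_poly Q * (f * fps_of_poly q)"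
    by (simp add: fps_of_poly_mult assms(2)[symmetric])
  finally have "fps_of_poly p = f * fps_of_poly q" using assms(1) by simp
  then have "fps_to_fls (fps_of_poly p) = fps_to_fls f * fps_to_fls (fps_of_poly q)"
    by (simp add: fls_times_fps_to_fls)
  then show ?thesis
    using \<open>q \<noteq> 0\<close> by (simp add: fls_of_ratfun_def pq)
qed

text \<open>A zero of \<open>q\<close> at \<open>x\<close> would, by \<open>p Q = P q\<close> and
  \<open>Q(x) \<noteq> 0\<close>, be a zero of \<open>p\<close> too, so a linear factor would divide
  the coprime \<open>p\<close> and \<open>q\<close>. Hence there is no pole, and the
  cross-multiplied identity gives the value.\<close>

lemma eval_ratfun_Fract:
  assumes "poly Q x \<noteq> 0"
  shows "eval_ratfun (Fract P Q) x = Some (poly P x / poly Q x)"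
proof -
  define p q where pq: "p = fst (quot_of_fract (Fract P Q))" "q = snd (quot_of_fract (Fract P Q))"
  have "Q \<noteq> 0" using assms by auto
  have eq: "poly p x * poly Q x = poly P x * poly q x"
    using arg_cong[OF quot_of_fract_cross[OF \<open>Q \<noteq> 0\<close>, of P], of "\<lambda>r. poly r x"] by (simp add: pq)
  have "poly q x \<noteq> 0"
  proof
    assume q: "poly q x = 0"
    then have "poly p x = 0" using eq assms by simp
    moreover have "coprime p q" unfolding pq by (rule coprime_quot_of_fract)
    ultimately have "is_unit [:-x, 1:]" using q by (simp add: poly_eq_0_iff_dvd coprime_common_divisor)
    then show False by (simp add: is_unit_iff_degree)
  qed
  then show ?thesis using eq assms by (simp add: eval_ratfun_def pq[symmetric] frac_eq_eq)
qed

text \<open>Any fraction for the nerve series with denominator nonzero at -1 will do. Injectivity of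
  the embedding resolves the definite description in \<open>series_euler_char\<close>.\<close>

lemma series_euler_charI:
  assumes "poly Q (-1) \<noteq> 0" "fps_of_poly Q * nerve_series C = fps_of_poly P"
  shows "has_series_euler_char C" "series_euler_char C = poly P (-1) / poly Q (-1)"
proof -
  have rep: "represents_nerve_series C (Fract P Q)"
    unfolding represents_nerve_series_def using assms by (intro fls_of_ratfun_Fract) auto
  then have "(THE r. represents_nerve_series C r) = Fract P Q"
    by (intro the_equality) (auto simp: represents_nerve_series_def intro: injD[OF inj_fls_of_ratfun])
  with rep show "has_series_euler_char C" "series_euler_char C = poly P (-1) / poly Q (-1)"
    by (auto simp: has_series_euler_char_def series_euler_char_def eval_ratfun_Fract[OF assms(1)])
qed

section \<open>Enumerations of the objects\<close>

context finite_category
begin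

text \<open>Finiteness gives the choice in \<open>obj_list\<close> a witness, so that sums over
  indices can be traded for sums over objects.\<close>

lemma bij_betw_obj_list: "bij_betw ((!) (obj_list C)) {..<card (obj C)} (obj C)"
proof -
  have "distinct (obj_list C) \<and> set (obj_list C) = obj C"
    unfolding obj_list_def using finite_distinct_list[OF finite_obj]
    by (intro someI_ex[of "\<lambda>xs. distinct xs \<and> set xs = obj C"]) blast
  then show ?thesis
    using distinct_card[of "obj_list C"] bij_betw_nth[of "obj_list C"] by auto
qed

lemma sum_obj_list: "(\<Sum>i<card (obj C). h (obj_list C ! i)) = (\<Sum>x\<in>obj C. h x)"
  using sum.reindex_bij_betw[OF bij_betw_obj_list] .

lemma obj_list_in_obj: "i < card (obj C) \<Longrightarrow> obj_list C ! i \<in> obj C"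
  using bij_betw_obj_list by (auto simp: bij_betw_def)

lemma weightingI:
  assumes "\<And>x. x \<in> obj C \<Longrightarrow> (\<Sum>y\<in>obj C. of_nat (card (homset C x y)) * u y) = 1"
  shows "weighting C (vec (card (obj C)) (\<lambda>i. u (obj_list C ! i)))"
  unfolding weighting_def
proof (intro conjI allI impI)
  fix i assume i: "i < card (obj C)"
  have "(\<Sum>j<card (obj C). of_nat (card (homset C (obj_list C ! i) (obj_list C ! j)))
      * u (obj_list C ! j)) = 1"
    using sum_obj_list[of "\<lambda>y. of_nat (card (homset C (obj_list C ! i) y)) * u y"]
      assms[OF obj_list_in_obj[OF i]] by simp
  then show "(\<Sum>j<card (obj C). zeta_mat C $$ (i, j)
      * vec (card (obj C)) (\<lambda>i. u (obj_list C ! i)) $ j) = 1"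
    using i by (simp add: zeta_mat_def)
qed simp

lemma coweightingI:
  assumes "\<And>y. y \<in> obj C \<Longrightarrow> (\<Sum>x\<in>obj C. u x * of_nat (card (homset C x y))) = 1"
  shows "coweighting C (vec (card (obj C)) (\<lambda>i. u (obj_list C ! i)))"
  unfolding coweighting_def
proof (intro conjI allI impI)
  fix j assume j: "j < card (obj C)"
  have "(\<Sum>i<card (obj C). u (obj_list C ! i)
      * of_nat (card (homset C (obj_list C ! i) (obj_list C ! j)))) = 1"
    using sum_obj_list[of "\<lambda>x. u x * of_nat (card (homset C x (obj_list C ! j)))"]
      assms[OF obj_list_in_obj[OF j]] by simp
  then show "(\<Sum>i<card (obj C). vec (card (obj C)) (\<lambda>i. u (obj_list C ! i)) $ i
      * zeta_mat C $$ (i, j)) = 1"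
    using j by (simp add: zeta_mat_def)
qed simp

lemma zeta_mat_carrier: "zeta_mat C \<in> carrier_mat (card (obj C)) (card (obj C))"
  by (simp add: zeta_mat_def)

section \<open>Moebius inversion: weights and skeletality\<close>

lemma inverse_zeta_mat:
  assumes "has_moebius_inversion C"
  obtains W where "W \<in> carrier_mat (card (obj C)) (card (obj C))"
    and "zeta_mat C * W = 1\<^sub>m (card (obj C))" "W * zeta_mat C = 1\<^sub>m (card (obj C))"
proof -
  obtain W where W: "zeta_mat C * W = 1\<^sub>m (card (obj C))" "W * zeta_mat C = 1\<^sub>m (dim_row W)"
    using assms zeta_mat_carrier
    by (auto simp: has_moebius_inversion_def invertible_mat_def inverts_mat_def)
  \<comment> \<open>Invertibility leaves the shape of \<open>W\<close> open; comparing column counts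
    in the two products fixes it.\<close>
  have "dim_col W = card (obj C)" "dim_row W = card (obj C)"
    using arg_cong[OF W(1), of dim_col] arg_cong[OF W(2), of dim_col] zeta_mat_carrier by auto
  then show ?thesis using that W by auto
qed

text \<open>The inverse matrix, reindexed by objects so that later arguments avoid the
  enumeration.\<close>

lemma moebius_function:
  assumes "has_moebius_inversion C"
  obtains \<mu> :: "'a \<Rightarrow> 'a \<Rightarrow> rat"
  where "\<And>x z. x \<in> obj C \<Longrightarrow> z \<in> obj C \<Longrightarrow>
      (\<Sum>y\<in>obj C. of_nat (card (homset C x y)) * \<mu> y z) = (if x = z then 1 else 0)"
    and "\<And>x z. x \<in> obj C \<Longrightarrow> z \<in> obj C \<Longrightarrow>
      (\<Sum>y\<in>obj C. \<mu> x y * of_nat (card (homset C y z))) = (if x = z then 1 else 0)"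
proof -
  let ?k = "card (obj C)" and ?xs = "obj_list C"
  define \<iota> where "\<iota> = inv_into {..<?k} ((!) ?xs)"
  have \<iota>: "\<iota> (?xs ! i) = i" if "i < ?k" for i
    using that bij_betw_obj_list unfolding \<iota>_def bij_betw_def by (auto intro: inv_into_f_f)
  obtain W where dim: "W \<in> carrier_mat ?k ?k"
    and W: "zeta_mat C * W = 1\<^sub>m ?k" "W * zeta_mat C = 1\<^sub>m ?k"
    using inverse_zeta_mat[OF assms] .
  have idx: "\<exists>i<?k. x = ?xs ! i" if "x \<in> obj C" for x
    using that bij_betw_obj_list by (auto simp: bij_betw_def)
  have inj: "?xs ! i = ?xs ! l \<longleftrightarrow> i = l" if "i < ?k" "l < ?k" for i l
    using \<iota> that by metis
  show ?thesis
  proof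
    fix x z assume "x \<in> obj C" "z \<in> obj C"
    then obtain i l where il: "i < ?k" "x = ?xs ! i" "l < ?k" "z = ?xs ! l" using idx by blast
    have "(\<Sum>j<?k. zeta_mat C $$ (i, j) * W $$ (j, l)) = (zeta_mat C * W) $$ (i, l)"
      using il dim zeta_mat_carrier
      by (auto simp: scalar_prod_def atLeast0LessThan intro!: sum.cong)
    also have "\<dots> = (if i = l then 1 else 0)" using il W(1) by simp
    finally have "(\<Sum>j<?k. zeta_mat C $$ (i, j) * W $$ (j, l)) = (if i = l then 1 else 0)" .
    then show "(\<Sum>y\<in>obj C. of_nat (card (homset C x y)) * W $$ (\<iota> y, \<iota> z))
        = (if x = z then 1 else 0)"
      using il by (simp add: sum_obj_list[symmetric] \<iota> inj zeta_mat_def)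
    have "(\<Sum>j<?k. W $$ (i, j) * zeta_mat C $$ (j, l)) = (W * zeta_mat C) $$ (i, l)"
      using il dim zeta_mat_carrier
      by (auto simp: scalar_prod_def atLeast0LessThan intro!: sum.cong)
    also have "\<dots> = (if i = l then 1 else 0)" using il W(2) dim by simp
    finally have "(\<Sum>j<?k. W $$ (i, j) * zeta_mat C $$ (j, l)) = (if i = l then 1 else 0)" .
    then show "(\<Sum>y\<in>obj C. W $$ (\<iota> x, \<iota> y) * of_nat (card (homset C y z)))
        = (if x = z then 1 else 0)"
      using il by (simp add: sum_obj_list[symmetric] \<iota> inj zeta_mat_def)
  qed
qed

text \<open>The weights are the row sums of \<open>\<mu>\<close> and the coweights its column
  sums.\<close>

lemma moebius_weights:
  assumes "has_moebius_inversion C"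
  obtains u v :: "'a \<Rightarrow> rat"
  where "\<And>x. x \<in> obj C \<Longrightarrow> (\<Sum>y\<in>obj C. of_nat (card (homset C x y)) * u y) = 1"
    and "\<And>y. y \<in> obj C \<Longrightarrow> (\<Sum>x\<in>obj C. v x * of_nat (card (homset C x y))) = 1"
proof -
  obtain \<mu> where \<mu>:
    "\<And>x z. x \<in> obj C \<Longrightarrow> z \<in> obj C \<Longrightarrow>
      (\<Sum>y\<in>obj C. rat_of_nat (card (homset C x y)) * \<mu> y z) = (if x = z then 1 else 0)"
    "\<And>x z. x \<in> obj C \<Longrightarrow> z \<in> obj C \<Longrightarrow>
      (\<Sum>y\<in>obj C. \<mu> x y * rat_of_nat (card (homset C y z))) = (if x = z then 1 else 0)"
    using moebius_function[OF assms] by blast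
  show ?thesis
  proof
    show "(\<Sum>y\<in>obj C. of_nat (card (homset C x y)) * (\<Sum>z\<in>obj C. \<mu> y z)) = 1"
      if "x \<in> obj C" for x
      unfolding sum_distrib_left
      by (subst sum.swap) (use that finite_obj in \<open>simp add: \<mu>(1)\<close>)
    show "(\<Sum>x\<in>obj C. (\<Sum>z\<in>obj C. \<mu> z x) * of_nat (card (homset C x y))) = 1"
      if "y \<in> obj C" for y
      unfolding sum_distrib_right
      by (subst sum.swap) (use that finite_obj in \<open>simp add: \<mu>(2)\<close>)
  qed
qed

text \<open>Isomorphic \<open>x\<close> and \<open>y\<close> give equal rows of \<open>Z\<close>.
  Pairing both rows with the column of \<open>\<mu>\<close> at \<open>x\<close> yields 1 for
  \<open>x\<close>, hence also for \<open>y\<close>, which forces \<open>y = x\<close>.\<close>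

lemma moebius_imp_skeletal:
  assumes "has_moebius_inversion C" "isomorphic C x y" "x \<in> obj C" "y \<in> obj C"
  shows "x = y"
proof -
  obtain \<mu> where \<mu>:
    "\<And>x z. x \<in> obj C \<Longrightarrow> z \<in> obj C \<Longrightarrow>
      (\<Sum>y\<in>obj C. rat_of_nat (card (homset C x y)) * \<mu> y z) = (if x = z then 1 else 0)"
    using moebius_function[OF assms(1)] by metis
  have "(\<Sum>z\<in>obj C. rat_of_nat (card (homset C x z)) * \<mu> z x)
      = (\<Sum>z\<in>obj C. rat_of_nat (card (homset C y z)) * \<mu> z x)"
    by (intro sum.cong refl) (simp only: card_homset_cong[OF assms(2) isomorphic_refl])
  then have "(1::rat) = (if y = x then 1 else 0)"
    unfolding \<mu>[OF assms(3,3)] \<mu>[OF assms(4,3)] by simp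
  then show ?thesis by (simp split: if_splits)
qed

end

text \<open>Every summand over \<open>A\<close> that factors through \<open>\<phi>\<close> can be
  summed over \<open>B\<close> with fibre sizes \<open>N\<close> as multiplicities
  (\<open>fib\<close>). Surjectivity makes \<open>N\<close> nonzero, so dividing by it is
  legitimate.\<close>

lemma euler_series_of_fibration:
  fixes A :: "('o, 'm) cat" and B :: "('p, 'n) cat" and \<phi> :: "'o \<Rightarrow> 'p"
  assumes "finite_category A" "finite_category B" and moebius: "has_moebius_inversion B"
    and onto: "\<phi> ` obj A = obj B"
    and hom: "\<And>x y. x \<in> obj A \<Longrightarrow> y \<in> obj A \<Longrightarrow>
      card (homset A x y) = card (homset B (\<phi> x) (\<phi> y))"
  shows "has_euler_char A \<and> has_series_euler_char A \<and> euler_char A = series_euler_char A"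
proof -
  interpret A: finite_category A by fact
  interpret B: finite_category B by fact
  define N where "N b = rat_of_nat (card {x \<in> obj A. \<phi> x = b})" for b
  define z where "z b c = rat_of_nat (card (homset B b c))" for b c
  have N: "N b \<noteq> 0" if "b \<in> obj B" for b
    using that A.finite_obj by (auto simp: N_def simp flip: onto)
  have fib: "(\<Sum>x\<in>obj A. h (\<phi> x)) = (\<Sum>b\<in>obj B. N b * h b)" for h :: "'p \<Rightarrow> rat"
    unfolding N_def using A.finite_obj B.finite_obj onto by (intro sum_fun_comp) auto
  have \<phi>: "\<phi> x \<in> obj B" if "x \<in> obj A" for x using that onto by auto
  obtain u v where u: "\<And>b. b \<in> obj B \<Longrightarrow> (\<Sum>c\<in>obj B. z b c * u c) = 1"
    and v: "\<And>c. c \<in> obj B \<Longrightarrow> (\<Sum>b\<in>obj B. v b * z b c) = 1"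
    using B.moebius_weights[OF moebius] unfolding z_def by metis

  \<comment> \<open>Each weight of \<open>B\<close> is shared equally among the objects of its
    fibre; the multiplicity \<open>N\<close> in \<open>fib\<close> cancels the division.\<close>
  have "(\<Sum>y\<in>obj A. of_nat (card (homset A x y)) * (u (\<phi> y) / N (\<phi> y))) = 1"
    if "x \<in> obj A" for x
    using that fib[of "\<lambda>c. z (\<phi> x) c * (u c / N c)"] u[OF \<phi>[OF that]]
    by (simp add: hom N flip: z_def)
  from A.weightingI[of "\<lambda>y. u (\<phi> y) / N (\<phi> y)", OF this] obtain w
    where w: "weighting A w"
      "w = vec (card (obj A)) (\<lambda>i. u (\<phi> (obj_list A ! i)) / N (\<phi> (obj_list A ! i)))"
    by blast
  have "(\<Sum>x\<in>obj A. (v (\<phi> x) / N (\<phi> x)) * of_nat (card (homset A x y))) = 1"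
    if "y \<in> obj A" for y
    using that fib[of "\<lambda>b. v b / N b * z b (\<phi> y)"] v[OF \<phi>[OF that]]
    by (simp add: hom N flip: z_def)
  from A.coweightingI[of "\<lambda>x. v (\<phi> x) / N (\<phi> x)", OF this] obtain w'
    where w': "coweighting A w'" by blast
  have "euler_char A = (\<Sum>x\<in>obj A. u (\<phi> x) / N (\<phi> x))"
    using euler_char_eq(1)[OF w(1) w'] w(2)
      A.sum_obj_list[of "\<lambda>x. u (\<phi> x) / N (\<phi> x)"] by simp
  also have "\<dots> = (\<Sum>b\<in>obj B. u b)"
    using fib[of "\<lambda>b. u b / N b"] by (simp add: N)
  finally have \<chi>: "euler_char A = (\<Sum>b\<in>obj B. u b)" .

  \<comment> \<open>\<open>h n b\<close> is to count the nondegenerate chains of length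
    \<open>n\<close> in \<open>A\<close> (not in \<open>B\<close>) from any one object over
    \<open>b\<close>. The factor \<open>N c\<close> counts the choices of target over
    \<open>c\<close>, and \<open>- g b\<close> discards the single identity.\<close>
  define h where "h = rec_nat (\<lambda>b. 1) (\<lambda>n g b. (\<Sum>c\<in>obj B. z b c * N c * g c) - g b)"
  have h0: "h 0 b = 1"
    and hS: "h (Suc n) b = (\<Sum>c\<in>obj B. z b c * N c * h n c) - h n b" for n b
    by (simp_all add: h_def)
  have h: "rat_of_nat (card (A.chains_from n x)) = h n (\<phi> x)" if "x \<in> obj A" for n x
    using that
  proof (induction n arbitrary: x)
    case 0
    then show ?case by (simp add: A.chains_from_0 h0)
  next
    case (Suc n)
    then show ?case
      using fib[of "\<lambda>c. z (\<phi> x) c * h n c"]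
      by (simp add: A.card_chains_from_Suc hS hom z_def[symmetric] ac_simps)
  qed
  define k where "k = card (obj B)"
  define e where "e i = obj_list B ! i" for i
  have e: "e i \<in> obj B" if "i < k" for i using B.obj_list_in_obj that by (simp add: e_def k_def)
  have sum_e: "(\<Sum>i<k. g (e i)) = (\<Sum>b\<in>obj B. g b)" for g :: "'p \<Rightarrow> rat"
    unfolding e_def k_def by (rule B.sum_obj_list)
  have nerve: "nerve_series A = Abs_fps (\<lambda>n. \<Sum>i<k. N (e i) * h n (e i))"
    unfolding nerve_series_def sum_e[of "\<lambda>b. N b * h _ b"]
    by (simp add: A.card_nondegenerate_simplices h fib)
  define M where "M = zeta_mat B * mat_diag k (\<lambda>i. N (e i))"
  have Z: "zeta_mat B \<in> carrier_mat k k" using B.zeta_mat_carrier by (simp add: k_def)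
  then have M: "M \<in> carrier_mat k k" by (simp add: M_def)
  have Mij: "M $$ (i, j) = z (e i) (e j) * N (e j)" if "i < k" "j < k" for i j
  proof -
    have "zeta_mat B $$ (i, j) = z (e i) (e j)"
      using that by (simp add: zeta_mat_def z_def e_def k_def)
    then show ?thesis using that unfolding M_def mat_diag_mult_right[OF Z] by simp
  qed
  have det_N: "det (mat_diag k (\<lambda>i. N (e i))) = (\<Prod>i<k. N (e i))"
    by (subst det_upper_triangular[of _ k])
      (auto simp: upper_triangular_def mat_diag_def prod_list_diag_prod atLeast0LessThan)
  obtain W where W: "W \<in> carrier_mat k k" "zeta_mat B * W = 1\<^sub>m k"
    using B.inverse_zeta_mat[OF moebius] unfolding k_def by metis
  \<comment> \<open>\<open>M\<close> is nonsingular as a product of the invertible \<open>Z\<close>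
    of \<open>B\<close> and a diagonal matrix with nonzero entries.\<close>
  have "det (zeta_mat B) \<noteq> 0"
    using det_mult[OF Z W(1)] W(2) by auto
  then have det: "det M \<noteq> 0"
    using N e det_N by (simp add: M_def det_mult[OF Z])
  \<comment> \<open>The solution of \<open>M x = 1\<close> is \<open>u / N\<close>, because
    \<open>M\<close> is \<open>Z\<close> times \<open>N\<close>. The coefficients \<open>N\<close>
    count initial objects and cancel the denominators, leaving the sum of \<open>u\<close>.\<close>
  obtain P Q where PQ: "poly Q (-1) \<noteq> 0"
    "fps_of_poly Q * Abs_fps (\<lambda>n. \<Sum>i<k. N (e i) * h n (e i)) = fps_of_poly P"
    "poly P (-1) = poly Q (-1) * (\<Sum>i<k. N (e i) * (u (e i) / N (e i)))"
  proof (rule iterates_generating_function[OF M det])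
    show "h 0 (e i) = 1" for i by (fact h0)
    show "h (Suc n) (e i) = (\<Sum>j<k. M $$ (i, j) * h n (e j)) - h n (e i)" if "i < k" for n i
      using that sum_e[of "\<lambda>c. z (e i) c * N c * h n c"] by (simp add: hS Mij)
    show "(\<Sum>j<k. M $$ (i, j) * (u (e j) / N (e j))) = 1" if "i < k" for i
      using that sum_e[of "\<lambda>c. z (e i) c * u c"] by (simp add: Mij N e u)
  qed
  have "(\<Sum>i<k. N (e i) * (u (e i) / N (e i))) = (\<Sum>b\<in>obj B. u b)"
    using sum_e[of u] by (simp add: N e)
  then have "poly P (-1) / poly Q (-1) = euler_char A" using PQ(1,3) \<chi> by simp
  then show ?thesis
    using series_euler_charI[OF PQ(1), of A P] PQ(2) nerve w(1) w'
    by (auto simp: has_euler_char_def)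
qed

theorem theorem3p2:
  fixes A :: "('o, 'm) cat" and B :: "('p, 'n) cat"
  assumes "finite_category A"
    and "finite_category B" and "has_moebius_inversion B"
    and "equivalent_cat A B"
  shows "has_euler_char A \<and> has_series_euler_char A \<and> euler_char A = series_euler_char A"
proof -
  obtain \<phi> where \<phi>: "\<And>x. x \<in> obj A \<Longrightarrow> \<phi> x \<in> obj B"
    "\<And>x y. x \<in> obj A \<Longrightarrow> y \<in> obj A \<Longrightarrow>
      card (homset A x y) = card (homset B (\<phi> x) (\<phi> y))"
    "\<And>b. b \<in> obj B \<Longrightarrow> \<exists>x\<in>obj A. isomorphic B (\<phi> x) b"
    using equivalence_object_map[OF assms(1,2,4)] by blast
  \<comment> \<open>Skeletality of \<open>B\<close> sharpens essential surjectivity to surjectivity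
    on objects.\<close>
  have "\<exists>x\<in>obj A. \<phi> x = b" if "b \<in> obj B" for b
    using \<phi>(1,3) that finite_category.moebius_imp_skeletal[OF assms(2,3)] by metis
  then have "\<phi> ` obj A = obj B" using \<phi>(1) by blast
  then show ?thesis using euler_series_of_fibration assms(1-3) \<phi>(2) by blast
qed

end
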